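(* Let $V_{R_0}\colon\mathbb R^d\times\mathbb R^d\to\mathbb R$ be such that for all $F\in\mathcal M^d\cup\{\delta_y : y\in\mathbb R^d\}$ and all $k\in\mathbb R^d$ $$\bar V_{R_0}(k,F)\in\begin{cases}(-\infty,0],&\text{if }k\notin R(F)\\ [0,\infty),&\text{if }k\in R(F).\end{cases}$$ (i) Suppose $R(Y)\in\widehat{\mathcal P}(\mathbb R^d;\mathbb R^d_+)$ for all $Y\in\mathcal Y^d$. Then for each $k\in\mathbb R^d$ the map $S_{R,k}\colon\widehat{\mathcal P}(\mathbb R^d;\mathbb R^d_+)\times\mathbb R^d\to[0,\infty)$, $$S_{R,k}(A,y)=\big(\mathbf 1_{R(y)\setminus A}(k)-\mathbf 1_{A\setminus R(y)}(k)\big)V_{R_0}(k,y),$$ is a non-negative $\mathcal M^d$-consistent exhaustive scoring function for $R\colon\mathcal M^d\to\widehat{\mathcal P}(\mathbb R^d;\mathbb R^d_+)$. (ii) Suppose $R(Y)\in\widehat{\mathcal P}(\mathbb R^d;\mathbb R^d_+)$ for all $Y\in\mathcal Y^d$ and let $\pi$ be a $\sigma$-finite non-negative measure on $\mathcal B(\mathbb R^d)$. Then the map $S_{R,\pi}\colon\widehat{\mathcal P}(\mathbb R^d;\mathbb R^d_+)\times\mathbb R^d\to[0,\infty]$, $$S_{R,\pi}(A,y)=\int_{\mathbb R^d}S_{R,k}(A,y)\,\pi(dk),$$ is a non-negative $\mathcal M^d$-consistent exhaustive scoring function for $R\colon\mathcal M^d\to\widehat{\mathcal P}(\mathbb R^d;\mathbb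 R^d_+)$. (iii) Suppose that for all $Y\in\mathcal Y^d$, $R(Y)\in\mathcal F(\mathbb R^d;\mathbb R^d_+)$ and $R_0(Y)$ equals the topological boundary $\partial R(Y)$; that $V_{R_0}$ is a strict selective $\mathcal M^d$-identification function for $R_0$; and that $\pi$ is a $\sigma$-finite strictly positive measure on $\mathcal B(\mathbb R^d)$. Then the restriction of $S_{R,\pi}$ to $\mathcal F(\mathbb R^d;\mathbb R^d_+)\times\mathbb R^d$ is strictly $\mathcal M^d_0$-consistent for $R\colon\mathcal M^d_0\to\mathcal F(\mathbb R^d;\mathbb R^d_+)$, where $\mathcal M^d_0\subseteq\mathcal M^d$ is such that $\bar S_{R,\pi}(R(F),F)<\infty$ for all $F\in\mathcal M^d_0$.
   Context: Setting: $(\Omega,\mathfrak F,\mathbb P)$ is an atomless probability space, $d\ge1$, $\mathcal Y^d\subseteq L^0(\Omega;\mathbb R^d)$ is a class of random vectors closed under translation by constants $k\in\mathbb R^d$. $\Lambda\colon\mathbb R^d\to\mathbb R$ is an aggregation function, i.e. non-decreasing for the componentwise order. $\mathcal Y\subseteq L^0(\Omega;\mathbb R)$ contains $\Lambda(Y)$ for all $Y\in\mathcal Y^d$ and is closed under translation by constants. $\mathcal M^d$ and $\mathcal M$ are the classes of distributions of elements of $\mathcal Y^d$ and $\mathcal Y$. $\rho\colon\mathcal Y\to\mathbb R$ is a law-invariant scalar risk measure that is cash-invariant ($\rho(X+m)=\rho(X)-m$) and monotone ($X\ge Z$ a.s. implies $\rho(X)\le\rho(Z)$). Define $R(Y)=\{k\in\mathbb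 R^d:\rho(\Lambda(Y+k))\le0\}$ and $R_0(Y)=\{k\in\mathbb R^d:\rho(\Lambda(Y+k))=0\}$; these are law-invariant and we write $R(F_Y)=R(Y)$, $R_0(F_Y)=R_0(Y)$. For $y\in\mathbb R^d$, $\delta_y$ is the point mass at $y$ and $R(y):=R(\delta_y)=\{k:\rho(\Lambda(y+k))\le0\}$, where $\rho$ is understood to be defined (with the same properties) on constants as well. $\widehat{\mathcal P}(\mathbb R^d;\mathbb R^d_+)$ is the class of Borel sets $B\subseteq\mathbb R^d$ with $B=B+\mathbb R^d_+$ (upper sets; $\emptyset$ is allowed) and $B\neq\mathbb R^d$. $\mathcal F(\mathbb R^d;\mathbb R^d_+)\subset\widehat{\mathcal P}(\mathbb R^d;\mathbb R^d_+)$ is the subclass of closed upper sets. A measure on $\mathcal B(\mathbb R^d)$ is strictly positive if it gives positive mass to every non-empty open set. Write $\bar V(k,F)=\int V(k,y)\,dF(y)$ and $\bar S(A,F)=\int S(A,y)\,dF(y)$; all integrals are tacitly assumed well defined (in particular $V_{R_0}$ and the integrands are jointly measurable). $V$ is a strict selective $\mathcal M^d$-identification function for $R_0$ if $\bar V(k,F)=0\iff k\in R_0(F)$ for all $k\in\mathbb R^d$, $F\in\mathcal M^d$. For a class $\mathcal A$ of Borel subsets of $\mathbb R^d$ and a class $\mathcal N$ of distributions, an exhaustive scoring function $S\colon\mathcal A\times\mathbb R^d\to(-\infty,\infty]$ is $\mathcal N$-consistent for $R\colon\mathcal N\to\mathcal A$ if $\bar S(R(F),F)\le\bar S(A,F)$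 for all $A\in\mathcal A$, $F\in\mathcal N$, and strictly $\mathcal N$-consistent if in addition equality implies $A=R(F)$. *)

theory Defs
  imports "HOL-Probability.Probability"
begin

section \<open>Random variables, laws and law-invariance\<close>

definition atomless :: "'w measure \<Rightarrow> bool" where
  "atomless M \<longleftrightarrow>
     (\<forall>A\<in>sets M. 0 < emeasure M A \<longrightarrow>
        (\<exists>B\<in>sets M. B \<subseteq> A \<and> 0 < emeasure M B \<and> emeasure M B < emeasure M A))"

text \<open>Elements of \<open>L\<^sup>0\<close> are represented by measurable functions.\<close>

definition constants :: "('w \<Rightarrow> 'b) set" where
  "constants = range (\<lambda>c \<omega>. c)"

definition laws :: "'w measure \<Rightarrow> ('w \<Rightarrow> 'b::topological_space) set \<Rightarrow> 'b measure set" where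
  "laws M D = (\<lambda>Y. distr M borel Y) ` D"

definition law_invariant ::
  "'w measure \<Rightarrow> ('w \<Rightarrow> 'b::topological_space) set \<Rightarrow> (('w \<Rightarrow> 'b) \<Rightarrow> 'c) \<Rightarrow> bool" where
  "law_invariant M D T \<longleftrightarrow>
     (\<forall>X\<in>D. \<forall>Z\<in>D. distr M borel X = distr M borel Z \<longrightarrow> T X = T Z)"

text \<open>The functional on laws induced by a law-invariant functional \<open>T\<close> on the domain \<open>D\<close>:
  it maps the law of \<open>Y\<close> to \<open>T Y\<close> for every \<open>Y\<close> in \<open>D\<close>.\<close>

definition on_laws ::
  "'w measure \<Rightarrow> ('w \<Rightarrow> 'b::topological_space) set \<Rightarrow> (('w \<Rightarrow> 'b) \<Rightarrow> 'c) \<Rightarrow> 'b measure \<Rightarrow> 'c" where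
  "on_laws M D T F = T (SOME Y. Y \<in> D \<and> distr M borel Y = F)"

lemma on_laws_distr:
  assumes "law_invariant M D T" "Y \<in> D"
  shows "on_laws M D T (distr M borel Y) = T Y"
proof -
  let ?P = "\<lambda>Z. Z \<in> D \<and> distr M borel Z = distr M borel Y"
  have "?P (SOME Z. ?P Z)"
    by (rule someI[of ?P Y]) (use assms in auto)
  then show ?thesis
    using assms unfolding on_laws_def law_invariant_def by blast
qed


section \<open>Set-valued systemic risk measures\<close>

definition risk_set ::
  "(('w \<Rightarrow> real) \<Rightarrow> real) \<Rightarrow> (real^'d \<Rightarrow> real) \<Rightarrow> ('w \<Rightarrow> real^'d) \<Rightarrow> (real^'d) set" where
  "risk_set \<rho> \<Lambda> Y = {k. \<rho> (\<lambda>\<omega>. \<Lambda> (Y \<omega> + k)) \<le> 0}"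

definition risk_set0 ::
  "(('w \<Rightarrow> real) \<Rightarrow> real) \<Rightarrow> (real^'d \<Rightarrow> real) \<Rightarrow> ('w \<Rightarrow> real^'d) \<Rightarrow> (real^'d) set" where
  "risk_set0 \<rho> \<Lambda> Y = {k. \<rho> (\<lambda>\<omega>. \<Lambda> (Y \<omega> + k)) = 0}"

text \<open>The risk measure \<open>\<rho>\<close> has its properties on \<open>\<Y>\<close> together with the constants, without the
  constants being required to lie in \<open>\<Y>\<close>.  The order on \<open>real^'d\<close> is componentwise.  The
  aggregation function is not required to be Borel measurable, so law-invariance of the
  two set-valued functionals on \<open>Yd\<close> is a separate clause; it follows from law-invariance of
  \<open>\<rho>\<close> when \<open>\<Lambda>\<close> is Borel measurable (lemma \<open>law_invariant_risk_sets_borel\<close>).\<close>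

locale systemic_risk = prob_space M
  for M :: "'w measure" +
  fixes Yd :: "('w \<Rightarrow> real^'d) set"
    and \<Y> :: "('w \<Rightarrow> real) set"
    and \<Lambda> :: "real^'d \<Rightarrow> real"
    and \<rho> :: "('w \<Rightarrow> real) \<Rightarrow> real"
  assumes atomless: "atomless M"
    and Yd_measurable: "Yd \<subseteq> borel_measurable M"
    and Yd_translate: "Y \<in> Yd \<Longrightarrow> (\<lambda>\<omega>. Y \<omega> + k) \<in> Yd"
    and mono_aggregation: "mono \<Lambda>"
    and Y_measurable: "\<Y> \<subseteq> borel_measurable M"
    and Y_aggregate: "Y \<in> Yd \<Longrightarrow> (\<lambda>\<omega>. \<Lambda> (Y \<omega>)) \<in> \<Y>"
    and Y_translate: "X \<in> \<Y> \<Longrightarrow> (\<lambda>\<omega>. X \<omega> + m) \<in> \<Y>"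
    and law_invariant: "law_invariant M (\<Y> \<union> constants) \<rho>"
    and cash_invariant: "X \<in> \<Y> \<union> constants \<Longrightarrow> \<rho> (\<lambda>\<omega>. X \<omega> + m) = \<rho> X - m"
    and monotone: "X \<in> \<Y> \<union> constants \<Longrightarrow> Z \<in> \<Y> \<union> constants \<Longrightarrow>
                     (AE \<omega> in M. Z \<omega> \<le> X \<omega>) \<Longrightarrow> \<rho> X \<le> \<rho> Z"
    and law_invariant_risk_set: "law_invariant M Yd (risk_set \<rho> \<Lambda>)"
    and law_invariant_risk_set0: "law_invariant M Yd (risk_set0 \<rho> \<Lambda>)"

text \<open>The law-based versions of \<open>R\<close> and \<open>R\<^sub>0\<close>, defined on the laws of \<open>Yd\<close> and on point masses.\<close>

definition R_law ::
  "'w measure \<Rightarrow> ('w \<Rightarrow> real^'d) set \<Rightarrow> (real^'d \<Rightarrow> real) \<Rightarrow> (('w \<Rightarrow> real) \<Rightarrow> real)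
     \<Rightarrow> (real^'d) measure \<Rightarrow> (real^'d) set" where
  "R_law M Yd \<Lambda> \<rho> = on_laws M (Yd \<union> constants) (risk_set \<rho> \<Lambda>)"

definition R0_law ::
  "'w measure \<Rightarrow> ('w \<Rightarrow> real^'d) set \<Rightarrow> (real^'d \<Rightarrow> real) \<Rightarrow> (('w \<Rightarrow> real) \<Rightarrow> real)
     \<Rightarrow> (real^'d) measure \<Rightarrow> (real^'d) set" where
  "R0_law M Yd \<Lambda> \<rho> = on_laws M (Yd \<union> constants) (risk_set0 \<rho> \<Lambda>)"

context systemic_risk
begin

lemma rho_AE_const:
  assumes "Y \<in> Yd" "AE \<omega> in M. Y \<omega> = y"
  shows "\<rho> (\<lambda>\<omega>. \<Lambda> (Y \<omega> + k)) = \<rho> (\<lambda>\<omega>. \<Lambda> (y + k))"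
proof (rule antisym)
  have 1: "(\<lambda>\<omega>. \<Lambda> (Y \<omega> + k)) \<in> \<Y> \<union> constants"
    using Y_aggregate[OF Yd_translate[OF assms(1)]] by blast
  have 2: "(\<lambda>\<omega>. \<Lambda> (y + k)) \<in> \<Y> \<union> constants"
    unfolding constants_def by blast
  show "\<rho> (\<lambda>\<omega>. \<Lambda> (Y \<omega> + k)) \<le> \<rho> (\<lambda>\<omega>. \<Lambda> (y + k))"
    by (rule monotone[OF 1 2]) (use assms(2) in auto)
  show "\<rho> (\<lambda>\<omega>. \<Lambda> (y + k)) \<le> \<rho> (\<lambda>\<omega>. \<Lambda> (Y \<omega> + k))"
    by (rule monotone[OF 2 1]) (use assms(2) in auto)
qed

lemma distr_constant: "distr M borel (\<lambda>_. y) = return borel y"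
  for y :: "real^'d"
  by (rule distr_const) simp

lemma AE_of_distr_return:
  fixes y :: "real^'d"
  assumes "Y \<in> borel_measurable M" "distr M borel Y = return borel y"
  shows "AE \<omega> in M. Y \<omega> = y"
proof -
  have "AE x in distr M borel Y. x = y"
    unfolding assms(2) by (subst AE_return) auto
  then show ?thesis
    by (subst (asm) AE_distr_iff) (use assms(1) in auto)
qed

lemma law_invariant_extend:
  fixes T :: "('w \<Rightarrow> real^'d) \<Rightarrow> 'c"
  assumes inv: "law_invariant M Yd T"
    and const: "\<And>Y y. Y \<in> Yd \<Longrightarrow> AE \<omega> in M. Y \<omega> = y \<Longrightarrow> T Y = T (\<lambda>_. y)"
  shows "law_invariant M (Yd \<union> constants) T"
proof -
  have mixed: "T Y = T (\<lambda>_. y)" if "Y \<in> Yd" "distr M borel Y = distr M borel (\<lambda>_. y)" for Y y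
  proof (rule const[OF that(1)], rule AE_of_distr_return)
    show "Y \<in> borel_measurable M" using that(1) Yd_measurable by blast
    show "distr M borel Y = return borel y" using that(2) distr_constant by (rule trans)
  qed
  have cc: "y = z" if "distr M borel (\<lambda>_. y) = distr M borel (\<lambda>_. z)" for y z :: "real^'d"
  proof -
    have "AE \<omega> in M. y = z"
      using that AE_of_distr_return[of "\<lambda>_. y" z] by (simp add: distr_constant)
    then show ?thesis by simp
  qed
  show ?thesis
    unfolding law_invariant_def constants_def
  proof (intro ballI impI)
    fix X Z assume X: "X \<in> Yd \<union> range (\<lambda>c \<omega>. c)" and Z: "Z \<in> Yd \<union> range (\<lambda>c \<omega>. c)"
      and eq: "distr M borel X = distr M borel Z"
    from X Z consider "X \<in> Yd" "Z \<in> Yd" | z where "X \<in> Yd" "Z = (\<lambda>_. z)"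
      | x where "Z \<in> Yd" "X = (\<lambda>_. x)" | x z where "X = (\<lambda>_. x)" "Z = (\<lambda>_. z)"
      by blast
    then show "T X = T Z"
    proof cases
      case 1 then show ?thesis using inv eq unfolding law_invariant_def by blast
    next
      case 2 then show ?thesis using mixed[of X z] eq by simp
    next
      case 3 then show ?thesis using mixed[of Z x] eq by simp
    next
      case 4 then show ?thesis using cc eq by metis
    qed
  qed
qed

lemma law_invariant_risk_set_constants:
  "law_invariant M (Yd \<union> constants) (risk_set \<rho> \<Lambda>)"
proof (rule law_invariant_extend[OF law_invariant_risk_set])
  fix Y y assume "Y \<in> Yd" "AE \<omega> in M. Y \<omega> = y"
  from rho_AE_const[OF this] show "risk_set \<rho> \<Lambda> Y = risk_set \<rho> \<Lambda> (\<lambda>_. y)"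
    unfolding risk_set_def by (simp only:)
qed

lemma law_invariant_risk_set0_constants:
  "law_invariant M (Yd \<union> constants) (risk_set0 \<rho> \<Lambda>)"
proof (rule law_invariant_extend[OF law_invariant_risk_set0])
  fix Y y assume "Y \<in> Yd" "AE \<omega> in M. Y \<omega> = y"
  from rho_AE_const[OF this] show "risk_set0 \<rho> \<Lambda> Y = risk_set0 \<rho> \<Lambda> (\<lambda>_. y)"
    unfolding risk_set0_def by (simp only:)
qed

lemma R_law_distr: "Y \<in> Yd \<Longrightarrow> R_law M Yd \<Lambda> \<rho> (distr M borel Y) = risk_set \<rho> \<Lambda> Y"
  unfolding R_law_def by (rule on_laws_distr[OF law_invariant_risk_set_constants]) simp

lemma R0_law_distr: "Y \<in> Yd \<Longrightarrow> R0_law M Yd \<Lambda> \<rho> (distr M borel Y) = risk_set0 \<rho> \<Lambda> Y"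
  unfolding R0_law_def by (rule on_laws_distr[OF law_invariant_risk_set0_constants]) simp

lemma R_law_return: "R_law M Yd \<Lambda> \<rho> (return borel y) = risk_set \<rho> \<Lambda> (\<lambda>_. y)"
proof -
  have "(\<lambda>_. y) \<in> Yd \<union> constants"
    unfolding constants_def by blast
  from on_laws_distr[OF law_invariant_risk_set_constants this] show ?thesis
    unfolding R_law_def distr_constant .
qed

end

lemma law_invariant_risk_sets_borel:
  fixes Yd :: "('w \<Rightarrow> real^'d) set"
  assumes \<Lambda>: "\<Lambda> \<in> borel_measurable borel"
    and Yd: "Yd \<subseteq> borel_measurable M"
    and translate: "\<And>Y k. Y \<in> Yd \<Longrightarrow> (\<lambda>\<omega>. Y \<omega> + k) \<in> Yd"
    and aggregate: "\<And>Y. Y \<in> Yd \<Longrightarrow> (\<lambda>\<omega>. \<Lambda> (Y \<omega>)) \<in> \<Y>"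
    and inv: "law_invariant M \<Y> \<rho>"
  shows "law_invariant M Yd (risk_set \<rho> \<Lambda>)" "law_invariant M Yd (risk_set0 \<rho> \<Lambda>)"
proof -
  have *: "\<rho> (\<lambda>\<omega>. \<Lambda> (X \<omega> + k)) = \<rho> (\<lambda>\<omega>. \<Lambda> (Z \<omega> + k))"
    if X: "X \<in> Yd" and Z: "Z \<in> Yd" and eq: "distr M borel X = distr M borel Z" for X Z k
  proof -
    have m: "(\<lambda>x. \<Lambda> (x + k)) \<in> borel_measurable borel"
      using \<Lambda> by measurable
    have "distr M borel (\<lambda>\<omega>. \<Lambda> (W \<omega> + k)) = distr (distr M borel W) borel (\<lambda>x. \<Lambda> (x + k))"
      if "W \<in> Yd" for W
      using Yd that m by (subst distr_distr) (auto simp: comp_def)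
    then have "distr M borel (\<lambda>\<omega>. \<Lambda> (X \<omega> + k)) = distr M borel (\<lambda>\<omega>. \<Lambda> (Z \<omega> + k))"
      using X Z eq by simp
    then show ?thesis
      using inv aggregate[OF translate[OF X]] aggregate[OF translate[OF Z]]
      unfolding law_invariant_def by blast
  qed
  show "law_invariant M Yd (risk_set \<rho> \<Lambda>)"
    unfolding law_invariant_def risk_set_def
    by (intro ballI impI Collect_cong, subst *) auto
  show "law_invariant M Yd (risk_set0 \<rho> \<Lambda>)"
    unfolding law_invariant_def risk_set0_def
    by (intro ballI impI Collect_cong, subst *) auto
qed


section \<open>Upper sets\<close>

text \<open>The sum of sets is the Minkowski sum; the empty set is included in both classes.\<close>

definition upper_sets :: "(real^'d) set set" where
  "upper_sets = {B. B \<in> sets borel \<and> B + {x. 0 \<le> x} = B \<and> B \<noteq> UNIV}"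

definition closed_upper_sets :: "(real^'d) set set" where
  "closed_upper_sets = {B \<in> upper_sets. closed B}"


section \<open>Identification and scoring functions\<close>

definition strict_selective_identification ::
  "'b measure set \<Rightarrow> ('b measure \<Rightarrow> 'a set) \<Rightarrow> ('a \<Rightarrow> 'b \<Rightarrow> real) \<Rightarrow> bool" where
  "strict_selective_identification \<N> T V \<longleftrightarrow>
     (\<forall>k. \<forall>F\<in>\<N>. integrable F (V k) \<and> ((\<integral>y. V k y \<partial>F) = 0 \<longleftrightarrow> k \<in> T F))"

text \<open>The integral of an extended real function as positive part minus negative part
  (\<open>e2ennreal\<close> sends negative numbers to 0); it is meaningful for functions that satisfy
  \<open>quasi_integrable\<close>.\<close>

definition quasi_integrable :: "'b measure \<Rightarrow> ('b \<Rightarrow> ereal) \<Rightarrow> bool" where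
  "quasi_integrable F f \<longleftrightarrow> f \<in> borel_measurable F \<and>
     ((\<integral>\<^sup>+ y. e2ennreal (f y) \<partial>F) < \<infinity> \<or> (\<integral>\<^sup>+ y. e2ennreal (- f y) \<partial>F) < \<infinity>)"

definition ext_integral :: "'b measure \<Rightarrow> ('b \<Rightarrow> ereal) \<Rightarrow> ereal" where
  "ext_integral F f =
     enn2ereal (\<integral>\<^sup>+ y. e2ennreal (f y) \<partial>F) - enn2ereal (\<integral>\<^sup>+ y. e2ennreal (- f y) \<partial>F)"

text \<open>Exhaustive scoring functions take a whole set as the report.\<close>

definition exhaustive_scoring_function ::
  "'a set set \<Rightarrow> 'b measure set \<Rightarrow> ('a set \<Rightarrow> 'b \<Rightarrow> ereal) \<Rightarrow> bool" where
  "exhaustive_scoring_function \<A> \<N> S \<longleftrightarrow>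
     (\<forall>A\<in>\<A>. (\<forall>y. S A y \<noteq> -\<infinity>) \<and> (\<forall>F\<in>\<N>. quasi_integrable F (S A)))"

definition consistent_scoring_function ::
  "'a set set \<Rightarrow> 'b measure set \<Rightarrow> ('b measure \<Rightarrow> 'a set) \<Rightarrow> ('a set \<Rightarrow> 'b \<Rightarrow> ereal) \<Rightarrow> bool" where
  "consistent_scoring_function \<A> \<N> T S \<longleftrightarrow>
     exhaustive_scoring_function \<A> \<N> S \<and> (\<forall>F\<in>\<N>. T F \<in> \<A>) \<and>
     (\<forall>A\<in>\<A>. \<forall>F\<in>\<N>. ext_integral F (S (T F)) \<le> ext_integral F (S A))"

definition strictly_consistent_scoring_function ::
  "'a set set \<Rightarrow> 'b measure set \<Rightarrow> ('b measure \<Rightarrow> 'a set) \<Rightarrow> ('a set \<Rightarrow> 'b \<Rightarrow> ereal) \<Rightarrow> bool" where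
  "strictly_consistent_scoring_function \<A> \<N> T S \<longleftrightarrow>
     consistent_scoring_function \<A> \<N> T S \<and>
     (\<forall>A\<in>\<A>. \<forall>F\<in>\<N>. ext_integral F (S (T F)) = ext_integral F (S A) \<longrightarrow> A = T F)"

definition strictly_positive :: "'a::topological_space measure \<Rightarrow> bool" where
  "strictly_positive \<pi> \<longleftrightarrow> (\<forall>U. open U \<and> U \<noteq> {} \<longrightarrow> 0 < emeasure \<pi> U)"

definition score_at ::
  "(('w \<Rightarrow> real) \<Rightarrow> real) \<Rightarrow> (real^'d \<Rightarrow> real) \<Rightarrow> (real^'d \<Rightarrow> real^'d \<Rightarrow> real)
     \<Rightarrow> real^'d \<Rightarrow> (real^'d) set \<Rightarrow> real^'d \<Rightarrow> real" where
  "score_at \<rho> \<Lambda> V k A y =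
     (let Ry = risk_set \<rho> \<Lambda> (\<lambda>_. y) in (indicator (Ry - A) k - indicator (A - Ry) k) * V k y)"

definition score_mix ::
  "(('w \<Rightarrow> real) \<Rightarrow> real) \<Rightarrow> (real^'d \<Rightarrow> real) \<Rightarrow> (real^'d \<Rightarrow> real^'d \<Rightarrow> real)
     \<Rightarrow> (real^'d) measure \<Rightarrow> (real^'d) set \<Rightarrow> real^'d \<Rightarrow> ereal" where
  "score_mix \<rho> \<Lambda> V \<pi> A y = ext_integral \<pi> (\<lambda>k. ereal (score_at \<rho> \<Lambda> V k A y))"

end

theory Submission
  imports Defs
begin

text \<open>Orientation on point masses gives \<open>V k y \<ge> 0\<close> for \<open>k \<in> R(y)\<close> and \<open>V k y \<le> 0\<close> otherwise, so the
  score equals \<open>max 0 (V k y) - 1\<^sub>A(k) V k y\<close>.  Only the second term of its mean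
  \<open>\<integral> max 0 (V k y) dF - 1\<^sub>A(k) \<integral> V k y dF\<close> depends on \<open>A\<close>, and by orientation at \<open>F\<close> it is best to
  include \<open>k\<close> in \<open>A\<close> exactly when \<open>k \<in> R F\<close>.  Tonelli transfers this to the mixture over \<open>\<pi>\<close>.
  If the mixed scores of \<open>A\<close> and \<open>R F\<close> agree and are finite, then \<open>\<integral> V k y dF = 0\<close>, that is
  \<open>k \<in> \<partial>(R F)\<close>, for \<open>\<pi>\<close>-almost all \<open>k\<close> in the symmetric difference of \<open>A\<close> and \<open>R F\<close>.  Hence the open
  sets \<open>int (R F) - A\<close> and \<open>int A - R F\<close> are null, thus empty, and a closed upper set is the
  closure of its interior.\<close>

section \<open>Integrals of non-negative extended real functions\<close>

lemma ext_integral_nonneg: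
  assumes "\<And>y. 0 \<le> f y"
  shows "ext_integral F f = enn2ereal (\<integral>\<^sup>+ y. e2ennreal (f y) \<partial>F)"
proof -
  have "e2ennreal (- f y) = 0" for y
    using assms[of y] by (simp add: e2ennreal_neg)
  then show ?thesis
    by (simp add: ext_integral_def zero_ennreal.rep_eq)
qed

lemma quasi_integrable_nonneg:
  assumes "f \<in> borel_measurable F" "\<And>y. 0 \<le> f y"
  shows "quasi_integrable F f"
proof -
  have "e2ennreal (- f y) = 0" for y
    using assms(2)[of y] by (simp add: e2ennreal_neg)
  then show ?thesis
    using assms(1) by (simp add: quasi_integrable_def)
qed

section \<open>Upper sets and strictly positive measures\<close>

lemma upper_set_mem:
  assumes "B \<in> upper_sets" "x \<in> B" "x \<le> z"
  shows "z \<in> B"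
proof -
  have "x + (z - x) \<in> B + {x. 0 \<le> x}"
    using assms(2,3) by (intro set_plus_intro) auto
  then show ?thesis
    using assms(1) by (simp add: upper_sets_def)
qed

text \<open>The open orthant \<open>U\<close> strictly above a point \<open>x\<close> of
  \<open>B\<close> consists of interior points of \<open>B\<close>, and \<open>x\<close> is a limit
  of points of that orthant.\<close>

lemma upper_set_subset_closure_interior:
  fixes B :: "(real^'d) set"
  assumes "B \<in> upper_sets"
  shows "B \<subseteq> closure (interior B)"
proof
  fix x assume x: "x \<in> B"
  define U where "U = {z. \<forall>i. z $ i \<in> {x $ i<..}}"
  have "open U"
    unfolding U_def by (rule open_vector_box) auto
  moreover have "U \<subseteq> B"
    using upper_set_mem[OF assms x] by (auto simp: U_def less_eq_vec_def less_imp_le)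
  ultimately have U: "U \<subseteq> interior B"
    by (rule interior_maximal[rotated])
  \<comment> \<open>The sequence descends to \<open>x\<close> along the diagonal, so every
    coordinate of \<open>f n\<close> strictly exceeds that of \<open>x\<close>.\<close>
  define f :: "nat \<Rightarrow> real^'d" where "f n = x + inverse (real (Suc n)) *\<^sub>R 1" for n
  have "f n \<in> interior B" for n
    using U by (auto simp: U_def f_def)
  moreover have "f \<longlonglongrightarrow> x + 0 *\<^sub>R 1"
    unfolding f_def by (intro tendsto_intros LIMSEQ_inverse_real_of_nat)
  ultimately show "x \<in> closure (interior B)"
    by (auto simp: closure_sequential)
qed

lemma strictly_positive_open_empty:
  assumes "strictly_positive \<pi>" "sets \<pi> = sets borel" "open U" "AE k in \<pi>. k \<notin> U"
  shows "U = {}"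
proof (rule ccontr)
  assume "U \<noteq> {}"
  have "U \<in> sets \<pi>"
    using assms(2,3) by simp
  then have "emeasure \<pi> U = 0"
    using assms(4) AE_iff_measurable[of U \<pi> "\<lambda>k. k \<notin> U"] sets.sets_into_space by blast
  then show False
    using assms(1,3) \<open>U \<noteq> {}\<close> by (auto simp: strictly_positive_def)
qed

lemma closed_upper_set_eqI:
  assumes \<pi>: "strictly_positive \<pi>" "sets \<pi> = sets borel"
    and A: "A \<in> closed_upper_sets" and B: "B \<in> closed_upper_sets"
    and AE: "AE k in \<pi>. (k \<in> A \<longleftrightarrow> k \<in> B) \<or> k \<in> frontier B"
  shows "A = B"
proof
  have cl: "closed A" "closed B" and up: "A \<in> upper_sets" "B \<in> upper_sets"
    using A B by (auto simp: closed_upper_sets_def)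
  have "interior A - B = {}"
  proof (rule strictly_positive_open_empty[OF \<pi>])
    show "open (interior A - B)"
      using cl by (intro open_Diff) auto
    \<comment> \<open>The exceptional points cause no harm: the closed set \<open>B\<close> contains
      its frontier.\<close>
    show "AE k in \<pi>. k \<notin> interior A - B"
      using AE by eventually_elim (use interior_subset cl frontier_subset_closed in fastforce)
  qed
  then show "A \<subseteq> B"
    using upper_set_subset_closure_interior[OF up(1)] closure_minimal[of "interior A" B] cl by blast
  have "interior B - A = {}"
  proof (rule strictly_positive_open_empty[OF \<pi>])
    show "open (interior B - A)"
      using cl by (intro open_Diff) auto
    \<comment> \<open>Here the exceptional points are excluded because frontier and interior are
      disjoint.\<close>
    show "AE k in \<pi>. k \<notin> interior B - A"
      using AE by eventually_elim (use interior_subset in \<open>fastforce simp: frontier_def\<close>)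
  qed
  then show "B \<subseteq> A"
    using upper_set_subset_closure_interior[OF up(2)] closure_minimal[of "interior B" A] cl by blast
qed

section \<open>Oriented identification functions and the score at a fixed \<open>k\<close>\<close>

locale oriented_identification = systemic_risk M Yd \<Y> \<Lambda> \<rho>
  for M :: "'w measure"
    and Yd :: "('w \<Rightarrow> real^'d) set"
    and \<Y> :: "('w \<Rightarrow> real) set"
    and \<Lambda> :: "real^'d \<Rightarrow> real"
    and \<rho> :: "('w \<Rightarrow> real) \<Rightarrow> real" +
  fixes V :: "real^'d \<Rightarrow> real^'d \<Rightarrow> real"
  assumes score_measurable:
      "\<And>A. A \<in> upper_sets \<Longrightarrow>
         (\<lambda>(k, y). score_at \<rho> \<Lambda> V k A y) \<in> borel_measurable (borel \<Otimes>\<^sub>M borel)"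
    and V_integrable: "\<And>F k. F \<in> laws M Yd \<union> range (return borel) \<Longrightarrow> integrable F (V k)"
    and V_nonpos: "\<And>F k. F \<in> laws M Yd \<union> range (return borel) \<Longrightarrow> k \<notin> R_law M Yd \<Lambda> \<rho> F \<Longrightarrow>
         (\<integral>y. V k y \<partial>F) \<le> 0"
    and V_nonneg: "\<And>F k. F \<in> laws M Yd \<union> range (return borel) \<Longrightarrow> k \<in> R_law M Yd \<Lambda> \<rho> F \<Longrightarrow>
         0 \<le> (\<integral>y. V k y \<partial>F)"
begin

abbreviation R :: "(real^'d) measure \<Rightarrow> (real^'d) set" where
  "R \<equiv> R_law M Yd \<Lambda> \<rho>"

abbreviation mean_score :: "(real^'d) measure \<Rightarrow> (real^'d) set \<Rightarrow> real^'d \<Rightarrow> real" where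
  "mean_score F A k \<equiv> \<integral>y. score_at \<rho> \<Lambda> V k A y \<partial>F"

lemma law_props:
  assumes "F \<in> laws M Yd"
  shows "sets F = sets borel" "prob_space F" "sigma_finite_measure F"
proof -
  obtain Y where "Y \<in> Yd" "F = distr M borel Y"
    using assms by (auto simp: laws_def)
  then show "sets F = sets borel" and p: "prob_space F"
    using Yd_measurable by (auto intro: prob_space_distr)
  interpret F: prob_space F by (rule p)
  show "sigma_finite_measure F" by unfold_locales
qed

lemma R_law_in:
  assumes "F \<in> laws M Yd" "\<forall>Y\<in>Yd. risk_set \<rho> \<Lambda> Y \<in> \<A>"
  shows "R F \<in> \<A>"
  using assms by (auto simp: laws_def R_law_distr)

text \<open>Integration against \<open>return borel y\<close> evaluates \<open>V k\<close> at
  \<open>y\<close>, so orientation at point masses becomes a pointwise sign condition.\<close>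

lemma V_sign:
  "k \<in> risk_set \<rho> \<Lambda> (\<lambda>_. y) \<Longrightarrow> 0 \<le> V k y"
  "k \<notin> risk_set \<rho> \<Lambda> (\<lambda>_. y) \<Longrightarrow> V k y \<le> 0"
proof -
  have "integrable (return borel y) (V k)"
    by (rule V_integrable) auto
  then have "(\<integral>z. V k z \<partial>return borel y) = V k y"
    by (intro integral_return) (auto dest: borel_measurable_integrable)
  then show "k \<in> risk_set \<rho> \<Lambda> (\<lambda>_. y) \<Longrightarrow> 0 \<le> V k y"
    "k \<notin> risk_set \<rho> \<Lambda> (\<lambda>_. y) \<Longrightarrow> V k y \<le> 0"
    using V_nonneg[of "return borel y" k] V_nonpos[of "return borel y" k]
    by (auto simp: R_law_return)
qed

text \<open>For \<open>k\<close> in \<open>R(y)\<close> the indicator difference is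
  \<open>1 - indicator A k\<close> and \<open>V k y\<close> is its own positive part; otherwise the
  difference is \<open>- indicator A k\<close> and the positive part vanishes.\<close>

lemma score_at_eq: "score_at \<rho> \<Lambda> V k A y = max 0 (V k y) - indicator A k * V k y"
  using V_sign[of k y] by (auto simp: score_at_def Let_def indicator_def)

lemma score_at_nonneg: "0 \<le> score_at \<rho> \<Lambda> V k A y"
  by (auto simp: score_at_eq indicator_def)

lemma score_at_integrable:
  assumes "F \<in> laws M Yd"
  shows "integrable F (score_at \<rho> \<Lambda> V k A)"
  unfolding score_at_eq[abs_def] using V_integrable[of F k] assms by auto

lemma mean_score_nonneg: "0 \<le> mean_score F A k"
  by (simp add: score_at_nonneg)

lemma mean_score_eq:
  assumes "F \<in> laws M Yd"
  shows "mean_score F A k = (\<integral>y. max 0 (V k y) \<partial>F) - indicator A k * (\<integral>y. V k y \<partial>F)"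
  unfolding score_at_eq using V_integrable[of F k] assms by simp

text \<open>The right side minus the left is \<open>(indicator (R F) k - indicator A k)\<close>
  times the mean of \<open>V k\<close>; whenever the first factor is nonzero, orientation at
  \<open>F\<close> makes the product non-negative.\<close>

lemma mean_score_le:
  assumes "F \<in> laws M Yd"
  shows "mean_score F (R F) k \<le> mean_score F A k"
  using V_nonneg[of F k] V_nonpos[of F k] assms
  by (auto simp: mean_score_eq indicator_def)

lemma nn_integral_score_at:
  assumes "F \<in> laws M Yd"
  shows "(\<integral>\<^sup>+ y. ennreal (score_at \<rho> \<Lambda> V k A y) \<partial>F) = ennreal (mean_score F A k)"
  by (rule nn_integral_eq_integral[OF score_at_integrable[OF assms]]) (simp add: score_at_nonneg)

lemma ext_integral_score_at:
  assumes "F \<in> laws M Yd"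
  shows "ext_integral F (\<lambda>y. ereal (score_at \<rho> \<Lambda> V k A y)) = ereal (mean_score F A k)"
proof -
  have "ext_integral F (\<lambda>y. ereal (score_at \<rho> \<Lambda> V k A y)) = enn2ereal (ennreal (mean_score F A k))"
    using nn_integral_score_at[OF assms] by (simp add: ext_integral_nonneg score_at_nonneg)
  then show ?thesis
    by (simp add: enn2ereal_ennreal mean_score_nonneg)
qed

lemma consistent_score_at:
  assumes "\<forall>Y\<in>Yd. risk_set \<rho> \<Lambda> Y \<in> upper_sets"
  shows "consistent_scoring_function upper_sets (laws M Yd) R
           (\<lambda>A y. ereal (score_at \<rho> \<Lambda> V k A y))"
  unfolding consistent_scoring_function_def exhaustive_scoring_function_def
proof (intro conjI ballI allI)
  fix A F assume "F \<in> laws M Yd"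
  then show "quasi_integrable F (\<lambda>y. ereal (score_at \<rho> \<Lambda> V k A y))"
    using score_at_integrable[of F k A]
    by (intro quasi_integrable_nonneg borel_measurable_ereal borel_measurable_integrable)
       (auto simp: score_at_nonneg)
qed (use assms in \<open>auto simp: ext_integral_score_at mean_score_le R_law_in\<close>)

section \<open>Mixtures of the scores over \<open>\<pi>\<close>\<close>

context
  fixes \<pi> :: "(real^'d) measure"
  assumes sets_\<pi>: "sets \<pi> = sets borel" and \<pi>: "sigma_finite_measure \<pi>"
begin

lemma score_mix_eq:
  "score_mix \<rho> \<Lambda> V \<pi> A y = enn2ereal (\<integral>\<^sup>+ k. ennreal (score_at \<rho> \<Lambda> V k A y) \<partial>\<pi>)"
  by (simp add: score_mix_def ext_integral_nonneg score_at_nonneg)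

lemma score_mix_nonneg: "0 \<le> score_mix \<rho> \<Lambda> V \<pi> A y"
  by (simp add: score_mix_eq)

lemma score_at_measurable_pair:
  assumes "sets F = sets borel" "A \<in> upper_sets"
  shows "(\<lambda>(k, y). ennreal (score_at \<rho> \<Lambda> V k A y)) \<in> borel_measurable (\<pi> \<Otimes>\<^sub>M F)"
proof -
  have "sets (\<pi> \<Otimes>\<^sub>M F) = sets (borel \<Otimes>\<^sub>M borel)"
    by (rule sets_pair_measure_cong) (use sets_\<pi> assms in auto)
  then have "(\<lambda>(k, y). score_at \<rho> \<Lambda> V k A y) \<in> borel_measurable (\<pi> \<Otimes>\<^sub>M F)"
    using score_measurable[OF assms(2)] by (simp cong: measurable_cong_sets)
  then show ?thesis
    by (auto simp: split_beta')
qed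

text \<open>The mean score is the inner integral over \<open>y\<close> of a jointly measurable
  non-negative function.\<close>

lemma mean_score_measurable:
  assumes "F \<in> laws M Yd" "A \<in> upper_sets"
  shows "(\<lambda>k. ennreal (mean_score F A k)) \<in> borel_measurable \<pi>"
proof -
  interpret F: sigma_finite_measure F by (rule law_props[OF assms(1)])
  show ?thesis
    using F.borel_measurable_nn_integral[OF score_at_measurable_pair[of F A]] law_props(1)[OF assms(1)]
      assms by (simp add: nn_integral_score_at)
qed

lemma score_mix_measurable:
  assumes "sets F = sets borel" "A \<in> upper_sets"
  shows "score_mix \<rho> \<Lambda> V \<pi> A \<in> borel_measurable F"
proof -
  interpret \<pi>: sigma_finite_measure \<pi> by (rule \<pi>)
  \<comment> \<open>The coordinates are swapped because here \<open>k\<close> is integrated out and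
    \<open>y\<close> remains.\<close>
  have "(\<lambda>(y, k). ennreal (score_at \<rho> \<Lambda> V k A y)) \<in> borel_measurable (F \<Otimes>\<^sub>M \<pi>)"
    using measurable_pair_swap[OF score_at_measurable_pair[OF assms]] by (simp add: split_beta')
  from \<pi>.borel_measurable_nn_integral[OF this] show ?thesis
    unfolding score_mix_eq[abs_def] by measurable
qed

text \<open>Tonelli applies since the score is non-negative and jointly measurable and both measures
  are sigma-finite; the common value may be infinite.\<close>

lemma ext_integral_score_mix:
  assumes "F \<in> laws M Yd" "A \<in> upper_sets"
  shows "ext_integral F (score_mix \<rho> \<Lambda> V \<pi> A) = enn2ereal (\<integral>\<^sup>+ k. ennreal (mean_score F A k) \<partial>\<pi>)"
proof -
  interpret pair_sigma_finite \<pi> F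
    unfolding pair_sigma_finite_def using \<pi> law_props[OF assms(1)] by blast
  have "ext_integral F (score_mix \<rho> \<Lambda> V \<pi> A) =
      enn2ereal (\<integral>\<^sup>+ y. \<integral>\<^sup>+ k. ennreal (score_at \<rho> \<Lambda> V k A y) \<partial>\<pi> \<partial>F)"
    using ext_integral_nonneg[of "score_mix \<rho> \<Lambda> V \<pi> A" F] by (simp add: score_mix_eq)
  also have "\<dots> = enn2ereal (\<integral>\<^sup>+ k. \<integral>\<^sup>+ y. ennreal (score_at \<rho> \<Lambda> V k A y) \<partial>F \<partial>\<pi>)"
    using Fubini'[OF score_at_measurable_pair[of F A]] law_props[OF assms(1)] assms by simp
  finally show ?thesis
    using assms by (simp add: nn_integral_score_at)
qed

text \<open>The report class and the class of laws are left general, to cover both all upper sets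
  with all laws and closed upper sets with the laws of finite minimal score.\<close>

lemma consistent_score_mix:
  assumes "\<forall>Y\<in>Yd. risk_set \<rho> \<Lambda> Y \<in> \<A>" "\<A> \<subseteq> upper_sets" "\<N> \<subseteq> laws M Yd"
  shows "consistent_scoring_function \<A> \<N> R (score_mix \<rho> \<Lambda> V \<pi>)"
  unfolding consistent_scoring_function_def exhaustive_scoring_function_def
proof (intro conjI ballI allI)
  fix A y
  show "score_mix \<rho> \<Lambda> V \<pi> A y \<noteq> - \<infinity>"
    using score_mix_nonneg[of A y] by auto
next
  fix A F assume "A \<in> \<A>" "F \<in> \<N>"
  then have A: "A \<in> upper_sets" and F: "F \<in> laws M Yd"
    using assms by auto
  show "quasi_integrable F (score_mix \<rho> \<Lambda> V \<pi> A)"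
    by (intro quasi_integrable_nonneg score_mix_measurable score_mix_nonneg law_props[OF F] A)
  have "R F \<in> upper_sets"
    using R_law_in[OF F assms(1)] assms(2) by blast
  then show "ext_integral F (score_mix \<rho> \<Lambda> V \<pi> (R F)) \<le> ext_integral F (score_mix \<rho> \<Lambda> V \<pi> A)"
    unfolding ext_integral_score_mix[OF F A] ext_integral_score_mix[OF F \<open>R F \<in> upper_sets\<close>]
      less_eq_ennreal.rep_eq[symmetric]
    by (intro nn_integral_mono ennreal_leI mean_score_le F)
next
  fix F assume "F \<in> \<N>"
  then show "R F \<in> \<A>"
    using R_law_in assms by blast
qed

lemma score_mix_eq_imp_eq:
  assumes Yd: "\<forall>Y\<in>Yd. risk_set \<rho> \<Lambda> Y \<in> closed_upper_sets \<and>
        risk_set0 \<rho> \<Lambda> Y = frontier (risk_set \<rho> \<Lambda> Y)"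
    and V: "strict_selective_identification (laws M Yd) (R0_law M Yd \<Lambda> \<rho>) V"
    and pos: "strictly_positive \<pi>"
    and F: "F \<in> laws M Yd" and A: "A \<in> closed_upper_sets"
    and fin: "ext_integral F (score_mix \<rho> \<Lambda> V \<pi> (R F)) < \<infinity>"
    and eq: "ext_integral F (score_mix \<rho> \<Lambda> V \<pi> (R F)) = ext_integral F (score_mix \<rho> \<Lambda> V \<pi> A)"
  shows "A = R F"
proof -
  have RF: "R F \<in> closed_upper_sets"
    using R_law_in[OF F] Yd by blast
  then have up: "A \<in> upper_sets" "R F \<in> upper_sets"
    using A by (auto simp: closed_upper_sets_def)
  have frontier: "R0_law M Yd \<Lambda> \<rho> F = frontier (R F)"
    using F Yd by (auto simp: laws_def R_law_distr R0_law_distr)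
  let ?m = "\<lambda>A. \<integral>\<^sup>+ k. ennreal (mean_score F A k) \<partial>\<pi>"
  have "?m (R F) = ?m A"
    using eq by (simp add: ext_integral_score_mix F up enn2ereal_inject)
  moreover have "?m (R F) \<noteq> \<infinity>"
    using fin by (auto simp: ext_integral_score_mix F up)
  \<comment> \<open>If this failed, the pointwise bound \<open>mean_score_le\<close> would be strict
    on a set that is not null, and finiteness of the smaller integral would make the integrals
    differ.\<close>
  ultimately have "AE k in \<pi>. ennreal (mean_score F A k) \<le> ennreal (mean_score F (R F) k)"
    using nn_integral_less[OF mean_score_measurable[OF F up(2)] mean_score_measurable[OF F up(1)]]
    by (auto simp: mean_score_le[OF F] ennreal_leI)
  then have "AE k in \<pi>. (k \<in> A \<longleftrightarrow> k \<in> R F) \<or> k \<in> frontier (R F)"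
  proof eventually_elim
    case (elim k)
    \<comment> \<open>Since mean scores are non-negative, the inequality in \<open>ennreal\<close>
      is one between reals; \<open>mean_score_le\<close> gives its converse.\<close>
    then have "mean_score F A k = mean_score F (R F) k"
      using mean_score_le[OF F, of k A] mean_score_nonneg[where F = F and A = "R F" and k = k] by (simp add: ennreal_le_iff)
    \<comment> \<open>If \<open>k\<close> lies in exactly one of the two sets, the mean scores
      differ by the mean of \<open>V k\<close>, up to sign.\<close>
    then have "(k \<in> A \<longleftrightarrow> k \<in> R F) \<or> (\<integral>y. V k y \<partial>F) = 0"
      by (auto simp: mean_score_eq[OF F] indicator_def split: if_splits)
    then show ?case
      using V F frontier by (auto simp: strict_selective_identification_def)
  qed
  then show ?thesis
    by (rule closed_upper_set_eqI[OF pos sets_\<pi> A RF])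
qed

end

end

theorem theorem3p8:
  fixes M :: "'w measure"
    and Yd :: "('w \<Rightarrow> real^'d) set"
    and \<Y> :: "('w \<Rightarrow> real) set"
    and \<Lambda> :: "real^'d \<Rightarrow> real"
    and \<rho> :: "('w \<Rightarrow> real) \<Rightarrow> real"
    and V :: "real^'d \<Rightarrow> real^'d \<Rightarrow> real"
  defines "Md \<equiv> laws M Yd"
    and "R \<equiv> R_law M Yd \<Lambda> \<rho>"
    and "R0 \<equiv> R0_law M Yd \<Lambda> \<rho>"
  assumes setting: "systemic_risk M Yd \<Y> \<Lambda> \<rho>"
    and V_measurable: "(\<lambda>(k, y). V k y) \<in> borel_measurable (borel \<Otimes>\<^sub>M borel)"
    and score_measurable:
      "\<forall>A\<in>upper_sets.
         (\<lambda>(k, y). score_at \<rho> \<Lambda> V k A y) \<in> borel_measurable (borel \<Otimes>\<^sub>M borel)"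
    and oriented:
      "\<forall>F \<in> Md \<union> range (return borel). \<forall>k.
         integrable F (V k) \<and>
         (k \<notin> R F \<longrightarrow> (\<integral>y. V k y \<partial>F) \<le> 0) \<and>
         (k \<in> R F \<longrightarrow> 0 \<le> (\<integral>y. V k y \<partial>F))"
  shows
    "((\<forall>Y\<in>Yd. risk_set \<rho> \<Lambda> Y \<in> upper_sets) \<longrightarrow>
       (\<forall>k. (\<forall>A\<in>upper_sets. \<forall>y. 0 \<le> score_at \<rho> \<Lambda> V k A y) \<and>
            consistent_scoring_function upper_sets Md R
              (\<lambda>A y. ereal (score_at \<rho> \<Lambda> V k A y))))
     \<and>
     ((\<forall>Y\<in>Yd. risk_set \<rho> \<Lambda> Y \<in> upper_sets) \<longrightarrow>
       (\<forall>\<pi>. sets \<pi> = sets borel \<and> sigma_finite_measure \<pi> \<longrightarrow>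
            (\<forall>A\<in>upper_sets. \<forall>y. 0 \<le> score_mix \<rho> \<Lambda> V \<pi> A y) \<and>
            consistent_scoring_function upper_sets Md R (score_mix \<rho> \<Lambda> V \<pi>)))
     \<and>
     ((\<forall>Y\<in>Yd. risk_set \<rho> \<Lambda> Y \<in> closed_upper_sets \<and>
              risk_set0 \<rho> \<Lambda> Y = frontier (risk_set \<rho> \<Lambda> Y)) \<and>
      strict_selective_identification Md R0 V \<longrightarrow>
       (\<forall>\<pi> M0. sets \<pi> = sets borel \<and> sigma_finite_measure \<pi> \<and> strictly_positive \<pi> \<and>
            M0 \<subseteq> Md \<and> (\<forall>F\<in>M0. ext_integral F (score_mix \<rho> \<Lambda> V \<pi> (R F)) < \<infinity>) \<longrightarrow>
            strictly_consistent_scoring_function closed_upper_sets M0 R (score_mix \<rho> \<Lambda> V \<pi>)))"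
proof -
  interpret oriented_identification M Yd \<Y> \<Lambda> \<rho> V
  proof (rule oriented_identification.intro[OF setting], unfold_locales)
  qed (use score_measurable oriented in \<open>auto simp: Md_def R_def\<close>)
  have sub: "closed_upper_sets \<subseteq> (upper_sets :: (real^'d) set set)"
    by (auto simp: closed_upper_sets_def)
  have strict: "strictly_consistent_scoring_function closed_upper_sets M0 R (score_mix \<rho> \<Lambda> V \<pi>)"
    if Yd: "\<forall>Y\<in>Yd. risk_set \<rho> \<Lambda> Y \<in> closed_upper_sets \<and>
         risk_set0 \<rho> \<Lambda> Y = frontier (risk_set \<rho> \<Lambda> Y)"
      and V: "strict_selective_identification Md R0 V"
      and \<pi>: "sets \<pi> = sets borel" "sigma_finite_measure \<pi>" and pos: "strictly_positive \<pi>"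
      and M0: "M0 \<subseteq> Md" "\<forall>F\<in>M0. ext_integral F (score_mix \<rho> \<Lambda> V \<pi> (R F)) < \<infinity>" for \<pi> M0
  proof -
    have "consistent_scoring_function closed_upper_sets M0 R (score_mix \<rho> \<Lambda> V \<pi>)"
      unfolding R_def using Yd M0 sub by (intro consistent_score_mix[OF \<pi>]) (auto simp: Md_def)
    moreover have "A = R F" if "A \<in> closed_upper_sets" "F \<in> M0"
      "ext_integral F (score_mix \<rho> \<Lambda> V \<pi> (R F)) = ext_integral F (score_mix \<rho> \<Lambda> V \<pi> A)" for A F
      using score_mix_eq_imp_eq[OF \<pi> Yd V[unfolded Md_def R0_def] pos, of F A] M0 that
      unfolding Md_def R_def by blast
    ultimately show ?thesis
      unfolding strictly_consistent_scoring_function_def by blast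
  qed
  show ?thesis
    \<comment> \<open>The two \<open>subset_refl\<close> fix the classes in
      \<open>consistent_score_mix\<close> as all upper sets and all laws of
      \<open>Yd\<close>.\<close>
    using score_at_nonneg consistent_score_at score_mix_nonneg strict
      consistent_score_mix[OF _ _ _ subset_refl subset_refl]
    unfolding Md_def R_def by (intro conjI impI allI ballI) blast+
qed

end
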